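(* Let $E$ be a Banach lattice. If $E$ is order isomorphic to $C(K)$ for some compact Hausdorff space $K$, then $E$ is lattice isomorphic to $C(K)$.
   Context: All vector spaces are real. $C(K)$ denotes the Banach lattice of real-valued continuous functions on $K$ with the pointwise order and the supremum norm. Two ordered vector spaces $E$ and $F$ are order isomorphic if there is a (not necessarily linear) bijection $T:E\to F$ (called an order isomorphism) such that, for all $x,y\in E$, $x\ge y$ if and only if $Tx\ge Ty$. Banach lattices $E$ and $F$ are lattice isomorphic if there is a linear bijection $T:E\to F$ such that $T|x|=|Tx|$ for all $x\in E$. *)

theory Defs
  imports "HOL-Analysis.Analysis" "HOL-Library.Lattice_Algebras" "HOL-Library.Function_Algebras"
begin

class vector_lattice = ordered_real_vector + lattice_ab_group_add_abs

class banach_lattice = vector_lattice + banach +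
  assumes norm_le_of_abs_le: "\<bar>x\<bar> \<le> \<bar>y\<bar> \<Longrightarrow> norm x \<le> norm y"

instance real :: banach_lattice
  by standard (auto simp: sup_real_def)

instantiation "fun" :: (type, real_vector) real_vector
begin

definition scaleR_fun_def: "c *\<^sub>R f = (\<lambda>x. c *\<^sub>R f x)"

instance
  by standard (simp_all add: scaleR_fun_def fun_eq_iff algebra_simps)

end

instantiation "fun" :: (type, vector_lattice) vector_lattice
begin

definition abs_fun_def: "\<bar>f\<bar> = (\<lambda>x. \<bar>f x\<bar>)"

instance
  by standard
    (simp_all add: abs_fun_def scaleR_fun_def fun_eq_iff le_fun_def
      abs_lattice scaleR_left_mono scaleR_right_mono)

end

text \<open>
  The space \<open>C(K)\<close>, with \<open>K\<close> given by a topology, so that the empty space is allowed.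
  A function on \<open>K\<close> is represented by its extension by \<open>0\<close> to the whole type; this makes
  \<open>C(K)\<close> a linear sublattice of the type of all functions, and on it the order and the
  operations of that type are the pointwise ones on \<open>K\<close>.
\<close>

definition continuous_functions :: "'k topology \<Rightarrow> ('k \<Rightarrow> real) set" where
  "continuous_functions K =
    {f. continuous_map K euclideanreal f \<and> (\<forall>x. x \<notin> topspace K \<longrightarrow> f x = 0)}"

lemma le_continuous_functions_iff:
  assumes "f \<in> continuous_functions K" "g \<in> continuous_functions K"
  shows "f \<le> g \<longleftrightarrow> (\<forall>x\<in>topspace K. f x \<le> g x)"
  using assms by (auto simp: continuous_functions_def le_fun_def)

lemma continuous_functions_closed:
  assumes "f \<in> continuous_functions K" "g \<in> continuous_functions K"
  shows "0 \<in> continuous_functions K"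
    and "f + g \<in> continuous_functions K"
    and "c *\<^sub>R f \<in> continuous_functions K"
    and "\<bar>f\<bar> \<in> continuous_functions K"
  using assms
  by (auto simp: continuous_functions_def plus_fun_def zero_fun_def scaleR_fun_def abs_fun_def
      intro!: continuous_intros)

definition order_isomorphism :: "'a::order set \<Rightarrow> 'b::order set \<Rightarrow> ('a \<Rightarrow> 'b) \<Rightarrow> bool" where
  "order_isomorphism A B T \<longleftrightarrow>
    bij_betw T A B \<and> (\<forall>x\<in>A. \<forall>y\<in>A. x \<ge> y \<longleftrightarrow> T x \<ge> T y)"

definition order_isomorphic :: "'a::order set \<Rightarrow> 'b::order set \<Rightarrow> bool" where
  "order_isomorphic A B \<longleftrightarrow> (\<exists>T. order_isomorphism A B T)"

text \<open>The following is intended for sets closed under the vector space operations and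
  absolute value.\<close>

definition lattice_isomorphism ::
    "'a::vector_lattice set \<Rightarrow> 'b::vector_lattice set \<Rightarrow> ('a \<Rightarrow> 'b) \<Rightarrow> bool" where
  "lattice_isomorphism A B T \<longleftrightarrow>
    bij_betw T A B \<and>
    (\<forall>x\<in>A. \<forall>y\<in>A. T (x + y) = T x + T y) \<and>
    (\<forall>c. \<forall>x\<in>A. T (c *\<^sub>R x) = c *\<^sub>R T x) \<and>
    (\<forall>x\<in>A. T \<bar>x\<bar> = \<bar>T x\<bar>)"

definition lattice_isomorphic :: "'a::vector_lattice set \<Rightarrow> 'b::vector_lattice set \<Rightarrow> bool" where
  "lattice_isomorphic A B \<longleftrightarrow> (\<exists>T. lattice_isomorphism A B T)"

end

(*
  Let T : E -> C(K) be an order isomorphism with T 0 = 0. Since C(K) has a countable cofinal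
  subset, so has E, and completeness of E turns it into an order unit e.

  For a point k of K call x in E locally nonnegative at k if its negative part is disjoint from
  some u >= 0 with T u k > 0. This cone is invariant under sums, positive multiples and meets, and
  it contains x - a e or b e - x whenever a < b. The last point is where the nonlinear map T enters:
  T preserves the relation "f and g agree on the support of h" for f, g, h >= 0, as this can be
  expressed by the order. Hence the supremum of all c for which x - c e is locally nonnegative at k
  defines a lattice homomorphism x |-> x(k) from E to the reals. These homomorphisms are continuous
  in k and determine the order of E. Elements of E whose images under T are cut-offs of T e separate
  disjoint closed sets of K, so successive approximation as in Tietze's theorem shows that E is
  mapped onto C(K).
*)

theory Submission
  imports Defs
begin

section \<open>Disjointness in vector lattices\<close>

text \<open>Subtracting \<open>a\<close> from the meet leaves a vector below both \<open>u\<close>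
  and \<open>b\<close>, hence below 0. So the meet is already below \<open>a\<close>, and
  disjointness of \<open>u\<close> and \<open>a\<close> finishes.\<close>

lemma inf_add_eq_0:
  fixes u a b :: "'a::lattice_ab_group_add"
  assumes "0 \<le> u" "0 \<le> a" "0 \<le> b" "inf u a = 0" "inf u b = 0"
  shows "inf u (a + b) = 0"
proof (rule antisym)
  let ?t = "inf u (a + b)"
  have "?t - a \<le> u"
    using assms(2) by (metis diff_le_eq inf.coboundedI1 le_add_same_cancel1)
  moreover have "?t - a \<le> b"
    by (simp add: diff_le_eq add.commute)
  ultimately have "?t - a \<le> inf u b"
    by (rule inf_greatest)
  then have "?t \<le> a"
    using assms by simp
  then have "?t \<le> inf u a"
    by simp
  then show "?t \<le> 0"
    using assms by simp
qed (use assms in simp)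

lemma inf_eq_0_mono:
  fixes u v a b :: "'a::lattice_ab_group_add"
  assumes "0 \<le> v" "v \<le> u" "0 \<le> a" "a \<le> b" "inf u b = 0"
  shows "inf v a = 0"
  by (metis antisym assms inf_greatest inf_mono)

text \<open>Multiplied by 1/(1 + c), the meet lies below both \<open>u\<close> and \<open>a\<close>.
  The summand 1 keeps the factor at most 1 and covers c = 0.\<close>

lemma inf_scaleR_eq_0:
  fixes u a :: "'a::vector_lattice"
  assumes "0 \<le> c" "0 \<le> u" "0 \<le> a" "inf u a = 0"
  shows "inf u (c *\<^sub>R a) = 0"
proof (rule antisym)
  let ?t = "inf u (c *\<^sub>R a)" and ?d = "1 / (1 + c)"
  have t0: "0 \<le> ?t"
    using assms by (simp add: scaleR_nonneg_nonneg)
  have "?d *\<^sub>R ?t \<le> 1 *\<^sub>R ?t"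
    using assms(1) t0 by (intro scaleR_right_mono) auto
  then have 1: "?d *\<^sub>R ?t \<le> u"
    by (simp add: le_infI1)
  have "?d *\<^sub>R ?t \<le> ?d *\<^sub>R (c *\<^sub>R a)"
    using assms(1) by (intro scaleR_left_mono) auto
  also have "\<dots> = (c / (1 + c)) *\<^sub>R a"
    by simp
  also have "\<dots> \<le> 1 *\<^sub>R a"
    using assms by (intro scaleR_right_mono) auto
  finally have "?d *\<^sub>R ?t \<le> a"
    by simp
  with 1 have "?d *\<^sub>R ?t \<le> 0"
    using assms(4) by (metis inf_greatest)
  then have "(1 + c) *\<^sub>R (?d *\<^sub>R ?t) \<le> (1 + c) *\<^sub>R 0"
    using assms(1) by (intro scaleR_left_mono) auto
  then show "?t \<le> 0"
    using assms(1) by simp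
qed (use assms in \<open>simp add: scaleR_nonneg_nonneg\<close>)

lemma inf_pprt_pprt_minus:
  fixes a :: "'a::lattice_ab_group_add"
  shows "inf (pprt a) (pprt (- a)) = 0"
proof -
  have "inf (pprt a) (pprt (- a)) = inf (a + pprt (- a)) (0 + pprt (- a))"
    by (metis add.left_neutral add.right_neutral add_diff_cancel_right' diff_minus_eq_add pprt_neg prts)
  also have "\<dots> = nprt a + pprt (- a)"
    by (simp add: add_inf_distrib_right nprt_def)
  finally show ?thesis
    by (simp add: pprt_neg)
qed

lemma pprt_le_iff:
  fixes a b :: "'a::lattice_ab_group_add"
  shows "pprt a \<le> b \<longleftrightarrow> a \<le> b \<and> 0 \<le> b"
  by (simp add: pprt_def)

lemma pprt_add_le:
  fixes a b :: "'a::lattice_ab_group_add"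
  shows "pprt (a + b) \<le> pprt a + pprt b"
  by (simp add: pprt_le_iff add_mono pprt_def)

lemma pprt_scaleR:
  fixes a :: "'a::vector_lattice"
  assumes "0 \<le> c"
  shows "pprt (c *\<^sub>R a) \<le> c *\<^sub>R pprt a"
  using assms by (simp add: pprt_le_iff pprt_def scaleR_left_mono scaleR_nonneg_nonneg)

section \<open>Order isomorphisms fixing the origin\<close>

text \<open>Stated for subsets, as C(K) is a set of functions and not a type, and abstractly, so
  that it serves both an isomorphism and its inverse. Differences are formed in the source,
  multiples and the Archimedean property are used in the target.\<close>

locale order_iso_fixing_0 =
  fixes A :: "'a::vector_lattice set" and B :: "'b::vector_lattice set"
    and T :: "'a \<Rightarrow> 'b" and S :: "'b \<Rightarrow> 'a"
  assumes A_0: "0 \<in> A" and A_diff: "x \<in> A \<Longrightarrow> y \<in> A \<Longrightarrow> x - y \<in> A"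
    and A_inf: "x \<in> A \<Longrightarrow> y \<in> A \<Longrightarrow> inf x y \<in> A"
    and B_scaleR: "u \<in> B \<Longrightarrow> c *\<^sub>R u \<in> B"
    and B_inf: "u \<in> B \<Longrightarrow> v \<in> B \<Longrightarrow> inf u v \<in> B"
    and B_archimedean: "(\<And>n::nat. real n *\<^sub>R u \<le> v) \<Longrightarrow> u \<le> 0"
    and T_in: "x \<in> A \<Longrightarrow> T x \<in> B" and S_in: "u \<in> B \<Longrightarrow> S u \<in> A"
    and S_T: "x \<in> A \<Longrightarrow> S (T x) = x" and T_S: "u \<in> B \<Longrightarrow> T (S u) = u"
    and T_le_iff: "x \<in> A \<Longrightarrow> y \<in> A \<Longrightarrow> T x \<le> T y \<longleftrightarrow> x \<le> y"
    and T_0: "T 0 = 0"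
begin

lemma T_inf:
  assumes "x \<in> A" "y \<in> A"
  shows "T (inf x y) = inf (T x) (T y)"
proof (rule antisym)
  show "T (inf x y) \<le> inf (T x) (T y)"
    using assms by (simp add: T_le_iff A_inf)
  have B: "inf (T x) (T y) \<in> B"
    using assms by (simp add: B_inf T_in)
  let ?z = "S (inf (T x) (T y))"
  have z: "?z \<in> A" "T ?z = inf (T x) (T y)"
    using B by (simp_all add: S_in T_S)
  then have "?z \<le> x" "?z \<le> y"
    using assms by (metis T_le_iff inf_le1, metis T_le_iff inf_le2)
  then have "T ?z \<le> T (inf x y)"
    by (subst T_le_iff) (use z assms in \<open>auto simp: A_inf\<close>)
  then show "inf (T x) (T y) \<le> T (inf x y)"
    by (simp only: z)
qed

lemma T_nonneg: "x \<in> A \<Longrightarrow> 0 \<le> x \<Longrightarrow> 0 \<le> T x"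
  by (metis A_0 T_0 T_le_iff)

lemma T_inf_eq_0: "x \<in> A \<Longrightarrow> y \<in> A \<Longrightarrow> inf x y = 0 \<Longrightarrow> inf (T x) (T y) = 0"
  by (metis T_0 T_inf)

text \<open>
  The assumption says that \<open>f\<close> and \<open>g\<close> agree on the support of \<open>h\<close>. Meeting both with
  elements of the band generated by \<open>h\<close> expresses this in terms of the order alone.
\<close>

lemma T_diff_disjoint:
  assumes A: "f \<in> A" "g \<in> A" "h \<in> A" and "0 \<le> g" "g \<le> f" "0 \<le> h"
    and disj: "inf (f - g) h = 0"
  shows "inf (T f - T g) (T h) = 0"
proof -
  have pos: "0 \<le> T g" "T g \<le> T f" "0 \<le> T h"
    using assms by (simp_all add: T_nonneg T_le_iff)
  \<comment> \<open>As \<open>T\<close> need not respect scalars, the multiples are taken in the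
    target and pulled back. The preimage \<open>?p\<close> is still disjoint from
    \<open>f - g\<close>, so below \<open>?p\<close> the vector \<open>f\<close> does not exceed
    \<open>g\<close>.\<close>
  have meet: "inf (T f) (real n *\<^sub>R T h) \<le> T g" for n
  proof -
    have w: "f - g \<in> A" "0 \<le> T (f - g)"
      using assms by (simp_all add: A_diff T_nonneg)
    let ?p = "S (real n *\<^sub>R T h)"
    have p: "?p \<in> A" "T ?p = real n *\<^sub>R T h"
      using A by (simp_all add: T_in B_scaleR S_in T_S)
    have "inf (T (f - g)) (real n *\<^sub>R T h) = 0"
      using T_inf_eq_0[OF w(1) A(3) disj] w pos by (intro inf_scaleR_eq_0) auto
    then have "T (inf (f - g) ?p) = T 0"
      using w p by (simp add: T_inf T_0)
    then have fp: "inf (f - g) ?p = 0"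
      using w p by (metis A_0 A_inf S_T)
    have "inf f ?p - g \<le> f - g"
      by simp
    moreover have "inf f ?p - g \<le> ?p"
      using \<open>0 \<le> g\<close> by (metis diff_le_eq inf.coboundedI2 le_add_same_cancel1)
    ultimately have "inf f ?p \<le> g"
      using fp by (metis diff_le_0_iff_le inf_greatest)
    then have "T (inf f ?p) \<le> T g"
      using A p by (simp add: T_le_iff A_inf)
    then show ?thesis
      using A p by (simp add: T_inf)
  qed
  let ?d = "inf (T f - T g) (T h)"
  \<comment> \<open>Since \<open>?d\<close> is below \<open>T f - T g\<close>, adding it to a vector
    below \<open>T g\<close> stays below \<open>T f\<close>. The sum is also below a multiple of
    \<open>T h\<close>, so \<open>meet\<close> pushes it back below \<open>T g\<close>.\<close>
  have "real n *\<^sub>R ?d \<le> T g" for n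
  proof (induction n)
    case 0
    then show ?case using pos by simp
  next
    case (Suc n)
    have "real (Suc n) *\<^sub>R ?d = real n *\<^sub>R ?d + ?d"
      by (simp add: algebra_simps)
    also have "\<dots> \<le> T g + (T f - T g)"
      using Suc by (intro add_mono) auto
    finally have "real (Suc n) *\<^sub>R ?d \<le> T f"
      by simp
    moreover have "real (Suc n) *\<^sub>R ?d \<le> real (Suc n) *\<^sub>R T h"
      by (intro scaleR_left_mono) auto
    ultimately show ?case
      using meet[of "Suc n"] by (meson inf_greatest order_trans)
  qed
  then have "?d \<le> 0"
    by (rule B_archimedean)
  moreover have "0 \<le> ?d"
    using pos by simp
  ultimately show ?thesis
    by (rule antisym)
qed

end

section \<open>Banach lattices\<close>

lemma norm_mono_nonneg:
  fixes x y :: "'a::banach_lattice"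
  assumes "0 \<le> x" "x \<le> y"
  shows "norm x \<le> norm y"
  using assms by (intro norm_le_of_abs_le) (simp add: abs_of_nonneg)

text \<open>The norm is monotone on the positive cone, so n times the norm of the positive part of
  \<open>x\<close> is at most \<open>norm y\<close> for all n.\<close>

lemma banach_lattice_archimedean:
  fixes x y :: "'a::banach_lattice"
  assumes "\<And>n::nat. real n *\<^sub>R x \<le> y"
  shows "x \<le> 0"
proof -
  have "0 \<le> y"
    using assms[of 0] by simp
  have "real n * norm (pprt x) \<le> norm y" for n
  proof -
    have "pprt (real n *\<^sub>R x) \<le> y"
      using assms[of n] \<open>0 \<le> y\<close> by (simp add: pprt_le_iff)
    moreover have "real n *\<^sub>R pprt x \<le> pprt (real n *\<^sub>R x)"
    proof (cases "n = 0")
      case False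
      then have "pprt (inverse (real n) *\<^sub>R (real n *\<^sub>R x)) \<le> inverse (real n) *\<^sub>R pprt (real n *\<^sub>R x)"
        by (intro pprt_scaleR) auto
      then have "real n *\<^sub>R pprt x \<le> real n *\<^sub>R inverse (real n) *\<^sub>R pprt (real n *\<^sub>R x)"
        using False by (intro scaleR_left_mono) auto
      then show ?thesis using False by simp
    qed simp
    ultimately have "norm (real n *\<^sub>R pprt x) \<le> norm y"
      by (intro norm_mono_nonneg) (auto intro: scaleR_nonneg_nonneg)
    then show ?thesis by simp
  qed
  then have "norm (pprt x) \<le> 0"
    by (meson norm_ge_zero not_le reals_Archimedean3)
  then show ?thesis
    by (simp add: le_zero_iff_zero_pprt)
qed

lemma banach_lattice_archimedean':
  fixes x e :: "'a::banach_lattice"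
  assumes "\<And>c. 0 < c \<Longrightarrow> x \<le> c *\<^sub>R e"
  shows "x \<le> 0"
proof (rule banach_lattice_archimedean)
  fix n :: nat
  show "real n *\<^sub>R x \<le> pprt e"
  proof (cases "n = 0")
    case False
    then have "real n *\<^sub>R x \<le> real n *\<^sub>R inverse (real n) *\<^sub>R e"
      by (intro scaleR_left_mono assms) auto
    also have "\<dots> \<le> pprt e"
      using False by (simp add: pprt_def)
    finally show ?thesis .
  qed simp
qed

text \<open>The positive cone is closed: once \<open>X n\<close> is nonnegative, the negative part
  of \<open>x\<close> is dominated by \<open>\<bar>X n - x\<bar>\<close>.\<close>

lemma banach_lattice_limit_nonneg:
  fixes X :: "nat \<Rightarrow> 'a::banach_lattice"
  assumes lim: "X \<longlonglongrightarrow> x" and nonneg: "eventually (\<lambda>n. 0 \<le> X n) sequentially"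
  shows "0 \<le> x"
proof -
  have "eventually (\<lambda>n. norm (pprt (- x)) \<le> norm (X n - x)) sequentially"
    using nonneg
  proof eventually_elim
    case (elim n)
    have "- x \<le> X n - x"
      using elim by simp
    then have "pprt (- x) \<le> \<bar>X n - x\<bar>"
      by (meson abs_ge_self abs_ge_zero order_trans pprt_le_iff)
    then show ?case
      by (intro norm_le_of_abs_le) (simp add: abs_of_nonneg)
  qed
  moreover have "(\<lambda>n. norm (X n - x)) \<longlonglongrightarrow> 0"
    using lim by (simp add: LIM_zero tendsto_norm_zero)
  ultimately have "norm (pprt (- x)) \<le> 0"
    by (intro tendsto_lowerbound[OF _ _ trivial_limit_sequentially])
  then have "- x \<le> 0"
    by (simp add: le_zero_iff_zero_pprt)
  then show ?thesis by simp
qed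

lemma banach_lattice_limit_le:
  fixes X :: "nat \<Rightarrow> 'a::banach_lattice"
  assumes "X \<longlonglongrightarrow> x" "eventually (\<lambda>n. X n \<le> y) sequentially"
  shows "x \<le> y"
  using banach_lattice_limit_nonneg[of "\<lambda>n. y - X n" "y - x"] assms
  by (simp add: tendsto_diff)

text \<open>Positive weights make the norm of the n-th term at most 2^(-n), so the series converges
  by completeness. Its sum dominates every term, because the terms are nonnegative and the cone is
  closed.\<close>

lemma dominating_element:
  fixes u :: "nat \<Rightarrow> 'a::banach_lattice"
  assumes nonneg: "\<And>n. 0 \<le> u n"
  obtains e where "0 \<le> e" "\<And>n. \<exists>c\<ge>0. u n \<le> c *\<^sub>R e"
proof -
  define c where "c n = (1/2)^n / (1 + norm (u n))" for n
  have den: "0 < 1 + norm (u n)" for n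
    by (simp add: add_pos_nonneg)
  have c: "0 < c n" for n
    using den by (simp add: c_def)
  have "summable (\<lambda>n. c n *\<^sub>R u n)"
  proof (rule summable_comparison_test')
    show "summable (\<lambda>n. (1/2::real)^n)"
      by (simp add: summable_geometric)
    show "norm (c n *\<^sub>R u n) \<le> (1/2)^n" for n
      using den[of n] mult_left_le[of "norm (u n) / (1 + norm (u n))" "(1/2)^n"] by (simp add: c_def)
  qed
  then have lim: "(\<lambda>n. \<Sum>i<n. c i *\<^sub>R u i) \<longlonglongrightarrow> (\<Sum>n. c n *\<^sub>R u n)"
    by (rule summable_LIMSEQ)
  define e where "e = (\<Sum>n. c n *\<^sub>R u n)"
  have nn: "0 \<le> c i *\<^sub>R u i" for i
    using c[of i] nonneg[of i] by (simp add: scaleR_nonneg_nonneg)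
  have le: "c n *\<^sub>R u n \<le> e" for n
  proof -
    have "eventually (\<lambda>m. 0 \<le> (\<Sum>i<m. c i *\<^sub>R u i) - c n *\<^sub>R u n) sequentially"
      using eventually_gt_at_top[of n]
    proof eventually_elim
      case (elim m)
      have "sum (\<lambda>i. c i *\<^sub>R u i) {n} \<le> sum (\<lambda>i. c i *\<^sub>R u i) {..<m}"
        using elim nn by (intro sum_mono2) auto
      then show ?case by simp
    qed
    then have "0 \<le> e - c n *\<^sub>R u n"
      using lim unfolding e_def
      by (intro banach_lattice_limit_nonneg[where X = "\<lambda>m. (\<Sum>i<m. c i *\<^sub>R u i) - c n *\<^sub>R u n"])
         (auto intro: tendsto_diff)
    then show ?thesis by simp
  qed
  have "\<exists>d\<ge>0. u n \<le> d *\<^sub>R e" for n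
  proof (intro exI conjI)
    have "inverse (c n) *\<^sub>R c n *\<^sub>R u n \<le> inverse (c n) *\<^sub>R e"
      using c[of n] by (intro scaleR_left_mono le) auto
    then show "u n \<le> inverse (c n) *\<^sub>R e"
      using c[of n] by simp
    show "0 \<le> inverse (c n)"
      using c[of n] by simp
  qed
  moreover have "0 \<le> e"
    using le[of 0] nn[of 0] by (rule order_trans[rotated])
  ultimately show ?thesis
    using that by blast
qed

section \<open>The space of continuous functions\<close>

lemma continuous_functionsD:
  assumes "f \<in> continuous_functions K"
  shows "continuous_map K euclideanreal f" "x \<notin> topspace K \<Longrightarrow> f x = 0"
  using assms by (auto simp: continuous_functions_def)

lemma restriction_in_continuous_functions:
  assumes "continuous_map K euclideanreal f"
  shows "(\<lambda>x. if x \<in> topspace K then f x else 0) \<in> continuous_functions K"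
  using continuous_map_eq[OF assms] by (simp add: continuous_functions_def)

lemma continuous_functions_diff:
  assumes "f \<in> continuous_functions K" "g \<in> continuous_functions K"
  shows "f - g \<in> continuous_functions K"
  using assms by (auto simp: continuous_functions_def fun_diff_def intro!: continuous_intros)

lemma continuous_functions_inf:
  assumes "f \<in> continuous_functions K" "g \<in> continuous_functions K"
  shows "inf f g \<in> continuous_functions K"
  using assms by (auto simp: continuous_functions_def inf_fun_def inf_real_def intro!: continuous_intros)

lemma real_fun_archimedean:
  fixes u v :: "'k \<Rightarrow> real"
  assumes "\<And>n::nat. real n *\<^sub>R u \<le> v"
  shows "u \<le> 0"
proof (rule le_funI)
  fix k
  have "real n * u k \<le> v k" for n
    using assms[of n] by (simp add: le_fun_def scaleR_fun_def)
  then show "u k \<le> 0 k"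
    by (metis not_le reals_Archimedean3 zero_fun_apply)
qed

text \<open>Compactness of \<open>K\<close> is recorded through consequences: normality, for
  Urysohn's lemma, and the order unit \<open>e\<close>. Below, \<open>T\<close> and its inverse
  \<open>S\<close> are both instances of the previous locale.\<close>

locale order_iso_to_continuous_functions =
  fixes K :: "'k topology"
    and T :: "'e::banach_lattice \<Rightarrow> 'k \<Rightarrow> real" and S :: "('k \<Rightarrow> real) \<Rightarrow> 'e" and e :: 'e
  assumes normal: "normal_space K"
    and T_in: "T x \<in> continuous_functions K"
    and S_T: "S (T x) = x"
    and T_S: "f \<in> continuous_functions K \<Longrightarrow> T (S f) = f"
    and T_le_iff: "T x \<le> T y \<longleftrightarrow> x \<le> y"
    and T_0: "T 0 = 0"
    and e_nonneg: "0 \<le> e"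
    and unit: "\<exists>c\<ge>0. x \<le> c *\<^sub>R e"
begin

sublocale T: order_iso_fixing_0 UNIV "continuous_functions K" T S
  by unfold_locales
    (auto simp: continuous_functions_closed(3) continuous_functions_inf
      T_in S_T T_S T_le_iff T_0 intro: real_fun_archimedean)

sublocale S: order_iso_fixing_0 "continuous_functions K" UNIV S T
proof unfold_locales
  show "S f \<le> S g \<longleftrightarrow> f \<le> g" if "f \<in> continuous_functions K" "g \<in> continuous_functions K" for f g
    using that by (metis T_S T_le_iff)
  show "S 0 = 0"
    by (metis S_T T_0)
qed (auto simp: continuous_functions_closed(1)[OF T_in T_in] continuous_functions_diff continuous_functions_inf
      T_in S_T T_S intro: banach_lattice_archimedean)

lemma T_nonneg_at: "0 \<le> x \<Longrightarrow> 0 \<le> T x k"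
  using T.T_nonneg[of x] by (simp add: le_fun_def)

lemma T_inf_at: "T (inf x y) k = min (T x k) (T y k)"
  by (simp add: T.T_inf inf_real_def)

section \<open>Vectors locally nonnegative at a point\<close>

text \<open>
  The positive vectors \<open>u\<close> with \<open>0 < T u k\<close> play the role of neighbourhoods of the
  point of the spectrum of \<open>'e\<close> that corresponds to \<open>k\<close>; \<open>x\<close> is locally nonnegative at \<open>k\<close> if
  its negative part vanishes on one of them. One cannot simply compare \<open>T x\<close> with \<open>T (c *\<^sub>R e)\<close>
  at \<open>k\<close>, because \<open>T (c *\<^sub>R e) k\<close> need not be strictly increasing in \<open>c\<close>.
\<close>

definition locally_nonneg :: "'k \<Rightarrow> 'e \<Rightarrow> bool" where
  "locally_nonneg k x \<longleftrightarrow> (\<exists>u\<ge>0. 0 < T u k \<and> inf u (pprt (- x)) = 0)"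

text \<open>Positivity is forced by dominating the preimage of the constant function 1; nothing so
  far makes \<open>T e k\<close> itself positive.\<close>

lemma exists_pos_at:
  assumes "k \<in> topspace K"
  obtains c where "0 \<le> c" "0 < T (c *\<^sub>R e) k"
proof -
  have c: "(\<lambda>x. if x \<in> topspace K then 1 else 0) \<in> continuous_functions K"
    by (intro restriction_in_continuous_functions) simp
  let ?u = "S (\<lambda>x. if x \<in> topspace K then 1 else 0)"
  obtain c where "0 \<le> c" "?u \<le> c *\<^sub>R e"
    using unit by blast
  then have "T ?u k \<le> T (c *\<^sub>R e) k"
    using T_le_iff by (auto simp: le_fun_def)
  moreover have "T ?u k = 1"
    using assms by (simp add: T_S[OF c])
  ultimately show ?thesis
    using that \<open>0 \<le> c\<close> by simp
qed

lemma locally_nonneg_nonneg: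
  assumes "k \<in> topspace K" "0 \<le> x"
  shows "locally_nonneg k x"
proof -
  obtain c where "0 \<le> c" "0 < T (c *\<^sub>R e) k"
    using exists_pos_at[OF assms(1)] .
  then show ?thesis
    unfolding locally_nonneg_def
    using assms e_nonneg by (intro exI[of _ "c *\<^sub>R e"]) (simp add: scaleR_nonneg_nonneg inf_absorb2)
qed

lemma locally_nonneg_mono:
  assumes "locally_nonneg k x" "x \<le> y"
  shows "locally_nonneg k y"
proof -
  obtain u where u: "0 \<le> u" "0 < T u k" "inf u (pprt (- x)) = 0"
    using assms(1) by (auto simp: locally_nonneg_def)
  have "inf u (pprt (- y)) = 0"
    by (rule inf_eq_0_mono[OF _ _ _ _ u(3)]) (use u assms(2) in auto)
  then show ?thesis
    using u by (auto simp: locally_nonneg_def)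
qed

text \<open>Neighbourhoods can be intersected: \<open>T\<close> turns the meet of two witnesses into
  a pointwise minimum, which is still positive at \<open>k\<close>.\<close>

lemma locally_nonneg_common:
  assumes "locally_nonneg k x" "locally_nonneg k y"
  obtains u where "0 \<le> u" "0 < T u k" "inf u (pprt (- x)) = 0" "inf u (pprt (- y)) = 0"
proof -
  obtain u v where u: "0 \<le> u" "0 < T u k" "inf u (pprt (- x)) = 0"
    and v: "0 \<le> v" "0 < T v k" "inf v (pprt (- y)) = 0"
    using assms by (auto simp: locally_nonneg_def)
  show ?thesis
  proof (rule that)
    show "inf (inf u v) (pprt (- x)) = 0"
      by (rule inf_eq_0_mono[OF _ _ _ _ u(3)]) (use u v in auto)
    show "inf (inf u v) (pprt (- y)) = 0"
      by (rule inf_eq_0_mono[OF _ _ _ _ v(3)]) (use u v in auto)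
  qed (use u v in \<open>auto simp: T_inf_at\<close>)
qed

lemma locally_nonneg_add:
  assumes "locally_nonneg k x" "locally_nonneg k y"
  shows "locally_nonneg k (x + y)"
proof -
  obtain u where u: "0 \<le> u" "0 < T u k" "inf u (pprt (- x)) = 0" "inf u (pprt (- y)) = 0"
    using locally_nonneg_common[OF assms] .
  have disj: "inf u (pprt (- x) + pprt (- y)) = 0"
    using u by (intro inf_add_eq_0) auto
  have "inf u (pprt (- (x + y))) = 0"
    by (rule inf_eq_0_mono[OF u(1) order_refl _ _ disj]) (use pprt_add_le[of "- x" "- y"] in auto)
  then show ?thesis
    using u by (auto simp: locally_nonneg_def)
qed

lemma locally_nonneg_scaleR:
  assumes "locally_nonneg k x" "0 \<le> c"
  shows "locally_nonneg k (c *\<^sub>R x)"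
proof -
  obtain u where u: "0 \<le> u" "0 < T u k" "inf u (pprt (- x)) = 0"
    using assms(1) by (auto simp: locally_nonneg_def)
  have disj: "inf u (c *\<^sub>R pprt (- x)) = 0"
    using u assms by (intro inf_scaleR_eq_0) auto
  have "inf u (pprt (- (c *\<^sub>R x))) = 0"
    by (rule inf_eq_0_mono[OF u(1) order_refl _ _ disj])
      (use pprt_scaleR[OF assms(2), of "- x"] in auto)
  then show ?thesis
    using u by (auto simp: locally_nonneg_def)
qed

lemma locally_nonneg_inf:
  assumes "locally_nonneg k x" "locally_nonneg k y"
  shows "locally_nonneg k (inf x y)"
proof -
  obtain u where u: "0 \<le> u" "0 < T u k" "inf u (pprt (- x)) = 0" "inf u (pprt (- y)) = 0"
    using locally_nonneg_common[OF assms] .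
  have disj: "inf u (pprt (- x) + pprt (- y)) = 0"
    using u by (intro inf_add_eq_0) auto
  have le: "pprt (- inf x y) \<le> pprt (- x) + pprt (- y)"
  proof -
    have "- x \<le> pprt (- x) + pprt (- y)" "- y \<le> pprt (- x) + pprt (- y)"
      by (metis add.right_neutral add_mono pprt_def sup_ge1 zero_le_pprt)
         (metis add.left_neutral add_mono pprt_def sup_ge1 zero_le_pprt)
    then show ?thesis
      by (simp add: pprt_le_iff neg_inf_eq_sup)
  qed
  have "inf u (pprt (- inf x y)) = 0"
    by (rule inf_eq_0_mono[OF u(1) order_refl _ le disj]) auto
  then show ?thesis
    using u by (auto simp: locally_nonneg_def)
qed

text \<open>Only 0 is disjoint from an order unit, and \<open>0 < T u k\<close> excludes
  \<open>u = 0\<close>. This makes the cone proper.\<close>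

lemma not_locally_nonneg_neg_unit:
  assumes "0 < c"
  shows "\<not> locally_nonneg k (- (c *\<^sub>R e))"
proof
  assume "locally_nonneg k (- (c *\<^sub>R e))"
  then obtain u where u: "0 \<le> u" "0 < T u k" "inf u (c *\<^sub>R e) = 0"
    using assms e_nonneg by (auto simp: locally_nonneg_def scaleR_nonneg_nonneg)
  obtain d where d: "0 \<le> d" "u \<le> d *\<^sub>R e"
    using unit by blast
  have "inf u ((d / c) *\<^sub>R c *\<^sub>R e) = 0"
    using u d assms e_nonneg by (intro inf_scaleR_eq_0[where a = "c *\<^sub>R e"]) (auto simp: scaleR_nonneg_nonneg)
  then have "u = 0"
    using assms d by (simp add: inf_absorb1)
  then show False
    using u(2) T_0 by simp
qed

text \<open>
  The vector \<open>y\<close> below is \<open>0\<close> where \<open>x \<ge> \<mu>\<close> and a large multiple of \<open>e\<close> where \<open>x \<le> \<alpha>\<close>, so that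
  one of \<open>T y\<close> and \<open>T (c *\<^sub>R e) - T y\<close> is positive at \<open>k\<close>.
\<close>

lemma locally_nonneg_cases:
  assumes k: "k \<in> topspace K" and "\<alpha> < \<mu>"
  shows "locally_nonneg k (x - \<alpha> *\<^sub>R e) \<or> locally_nonneg k (\<mu> *\<^sub>R e - x)"
proof -
  define \<delta> where "\<delta> = \<mu> - \<alpha>"
  have \<delta>: "0 < \<delta>" "\<mu> = \<alpha> + \<delta>"
    using assms by (auto simp: \<delta>_def)
  obtain c where c: "0 \<le> c" "0 < T (c *\<^sub>R e) k"
    using exists_pos_at[OF k] .
  \<comment> \<open>The truncation at \<delta> gives \<open>z\<close> full height where x is at most
    \<alpha>. Rescaling turns this height into \<open>c *\<^sub>R e\<close>, whose image is positive
    at \<open>k\<close>.\<close>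
  define z where "z = inf (pprt (\<mu> *\<^sub>R e - x)) (\<delta> *\<^sub>R e)"
  define y where "y = (c / \<delta>) *\<^sub>R z"
  have z: "0 \<le> z" "z \<le> \<delta> *\<^sub>R e"
    using \<delta> e_nonneg by (auto simp: z_def scaleR_nonneg_nonneg)
  have cd: "0 \<le> c / \<delta>"
    using c \<delta> by simp
  have y: "0 \<le> y" "y \<le> c *\<^sub>R e"
    using scaleR_nonneg_nonneg[OF cd z(1)] scaleR_left_mono[OF z(2) cd] \<delta>
    by (auto simp: y_def)
  have y_disj: "inf y (pprt (x - \<mu> *\<^sub>R e)) = 0"
  proof -
    have "inf (pprt (x - \<mu> *\<^sub>R e)) z = 0"
      by (rule inf_eq_0_mono[OF zero_le_pprt order_refl z(1) _ inf_pprt_pprt_minus]) (simp add: z_def)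
    then show ?thesis
      unfolding y_def using z cd by (subst inf_commute) (intro inf_scaleR_eq_0, auto)
  qed
  have cy_disj: "inf (c *\<^sub>R e - y) (pprt (\<alpha> *\<^sub>R e - x)) = 0"
  proof -
    have "\<delta> *\<^sub>R e - z \<le> pprt (x - \<alpha> *\<^sub>R e)"
    proof -
      have "\<delta> *\<^sub>R e - pprt (\<mu> *\<^sub>R e - x) \<le> \<delta> *\<^sub>R e - (\<mu> *\<^sub>R e - x)"
        by (simp add: pprt_def)
      also have "\<dots> = x - \<alpha> *\<^sub>R e"
        by (simp add: \<delta> algebra_simps)
      also have "\<dots> \<le> pprt (x - \<alpha> *\<^sub>R e)"
        by (simp add: pprt_def)
      finally have "\<delta> *\<^sub>R e - pprt (x - \<alpha> *\<^sub>R e) \<le> pprt (\<mu> *\<^sub>R e - x)"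
        by (simp add: algebra_simps)
      then have "\<delta> *\<^sub>R e - pprt (x - \<alpha> *\<^sub>R e) \<le> z"
        by (simp add: z_def algebra_simps)
      then show ?thesis
        by (simp add: algebra_simps)
    qed
    then have "inf (pprt (\<alpha> *\<^sub>R e - x)) (\<delta> *\<^sub>R e - z) = 0"
      by (intro inf_eq_0_mono[OF zero_le_pprt order_refl _ _ inf_pprt_pprt_minus]) (use z in auto)
    then have "inf (pprt (\<alpha> *\<^sub>R e - x)) ((c / \<delta>) *\<^sub>R (\<delta> *\<^sub>R e - z)) = 0"
      using z cd by (intro inf_scaleR_eq_0) auto
    moreover have "(c / \<delta>) *\<^sub>R (\<delta> *\<^sub>R e - z) = c *\<^sub>R e - y"
      using \<delta> by (simp add: y_def algebra_simps)
    ultimately show ?thesis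
      by (simp add: inf_commute)
  qed
  show ?thesis
  proof (cases "0 < T y k")
    case True
    then show ?thesis
      using y y_disj by (auto simp: locally_nonneg_def)
  next
    case False
    \<comment> \<open>In general \<open>?f\<close> is not \<open>T (c *\<^sub>R e - y)\<close>, so
      disjointness from the image of the negative part of \<open>x - \<alpha> *\<^sub>R e\<close>
      needs \<open>T_diff_disjoint\<close>. The witness is then the preimage of
      \<open>?f\<close>.\<close>
    let ?f = "T (c *\<^sub>R e) - T y"
    have f: "?f \<in> continuous_functions K"
      by (intro continuous_functions_diff T_in)
    have "inf ?f (T (pprt (\<alpha> *\<^sub>R e - x))) = 0"
      using y cy_disj by (intro T.T_diff_disjoint) auto
    then have "T (inf (S ?f) (pprt (\<alpha> *\<^sub>R e - x))) = T 0"
      by (simp add: T.T_inf T_S[OF f] T_0)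
    then have "inf (S ?f) (pprt (\<alpha> *\<^sub>R e - x)) = 0"
      by (metis S_T)
    moreover have "0 \<le> S ?f"
      using y f by (intro S.T_nonneg) (auto simp: T_le_iff)
    moreover have "0 < T (S ?f) k"
      using False c by (simp add: T_S[OF f])
    ultimately show ?thesis
      by (auto simp: locally_nonneg_def)
  qed
qed

section \<open>Evaluation at a point as a lattice homomorphism\<close>

definition eval_at :: "'k \<Rightarrow> 'e \<Rightarrow> real" where
  "eval_at k x = Sup {c. locally_nonneg k (x - c *\<^sub>R e)}"

context
  fixes k
  assumes k: "k \<in> topspace K"
begin

text \<open>The lower and the upper set of the Dedekind cut do not cross, because the sum of the two
  vectors is a multiple of \<open>e\<close>.\<close>

lemma locally_nonneg_bounds:
  assumes "locally_nonneg k (x - a *\<^sub>R e)" "locally_nonneg k (b *\<^sub>R e - x)"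
  shows "a \<le> b"
proof (rule ccontr)
  assume "\<not> a \<le> b"
  then have "0 < a - b" by simp
  moreover have "locally_nonneg k (- ((a - b) *\<^sub>R e))"
    using locally_nonneg_add[OF assms] by (simp add: algebra_simps)
  ultimately show False
    using not_locally_nonneg_neg_unit by blast
qed

lemma exists_upper: "\<exists>b. locally_nonneg k (b *\<^sub>R e - x)"
  using unit[of x] locally_nonneg_nonneg[OF k] by (metis diff_ge_0_iff_ge)

lemma exists_lower: "\<exists>a. locally_nonneg k (x - a *\<^sub>R e)"
  using exists_upper[of "- x"] by (metis add.commute diff_conv_add_uminus minus_minus scaleR_minus_left)

lemma le_eval_at:
  assumes "locally_nonneg k (x - a *\<^sub>R e)"
  shows "a \<le> eval_at k x"
proof -
  have "bdd_above {c. locally_nonneg k (x - c *\<^sub>R e)}"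
    using exists_upper[of x] locally_nonneg_bounds by (auto simp: bdd_above_def)
  then show ?thesis
    unfolding eval_at_def using assms by (intro cSup_upper) auto
qed

lemma eval_at_le:
  assumes "locally_nonneg k (b *\<^sub>R e - x)"
  shows "eval_at k x \<le> b"
  unfolding eval_at_def using assms exists_lower[of x] locally_nonneg_bounds by (intro cSup_least) auto

text \<open>The cut has no gap: for b strictly between a and the value, the other alternative of
  \<open>locally_nonneg_cases\<close> would bound the value by b.\<close>

lemma locally_nonneg_below:
  assumes "a < eval_at k x"
  shows "locally_nonneg k (x - a *\<^sub>R e)"
proof -
  obtain b where "a < b" "b < eval_at k x"
    using assms dense by blast
  then show ?thesis
    using locally_nonneg_cases[OF k, of a b x] eval_at_le[of b x] by auto
qed

lemma locally_nonneg_above: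
  assumes "eval_at k x < b"
  shows "locally_nonneg k (b *\<^sub>R e - x)"
proof -
  obtain a where "eval_at k x < a" "a < b"
    using assms dense by blast
  then show ?thesis
    using locally_nonneg_cases[OF k, of a b x] le_eval_at[of x a] by auto
qed

lemma eval_at_mono:
  assumes "x \<le> y"
  shows "eval_at k x \<le> eval_at k y"
proof (rule dense_le)
  fix a assume "a < eval_at k x"
  then show "a \<le> eval_at k y"
    by (intro le_eval_at) (rule locally_nonneg_mono[OF locally_nonneg_below], use assms in auto)
qed

text \<open>Negation exchanges the two sides of the cut.\<close>

lemma eval_at_minus: "eval_at k (- x) = - eval_at k x"
proof (rule antisym)
  show "eval_at k (- x) \<le> - eval_at k x"
  proof (rule dense_ge)
    fix a assume "- eval_at k x < a"
    then have "locally_nonneg k (x - (- a) *\<^sub>R e)"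
      by (intro locally_nonneg_below) simp
    then show "eval_at k (- x) \<le> a"
      by (intro eval_at_le) (simp add: add.commute)
  qed
  show "- eval_at k x \<le> eval_at k (- x)"
  proof (rule dense_le)
    fix a assume "a < - eval_at k x"
    then have "locally_nonneg k ((- a) *\<^sub>R e - x)"
      by (intro locally_nonneg_above) simp
    moreover have "(- a) *\<^sub>R e - x = - x - a *\<^sub>R e"
      by (metis minus_diff_commute scaleR_minus_left)
    ultimately show "a \<le> eval_at k (- x)"
      by (intro le_eval_at) (simp only:)
  qed
qed

text \<open>The cone is closed under sums, so lower sets add. Negation then yields the converse
  inequality in \<open>eval_at_add\<close>.\<close>

lemma eval_at_superadd: "eval_at k x + eval_at k y \<le> eval_at k (x + y)"
proof (rule dense_le)
  fix a assume "a < eval_at k x + eval_at k y"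
  then have "a - eval_at k y < eval_at k x"
    by simp
  then obtain b where b: "a - eval_at k y < b" "b < eval_at k x"
    using dense by blast
  then have "locally_nonneg k ((x - b *\<^sub>R e) + (y - (a - b) *\<^sub>R e))"
    by (intro locally_nonneg_add locally_nonneg_below) auto
  then show "a \<le> eval_at k (x + y)"
    by (intro le_eval_at) (simp add: algebra_simps)
qed

lemma eval_at_add: "eval_at k (x + y) = eval_at k x + eval_at k y"
proof (rule antisym)
  have "eval_at k (- x) + eval_at k (- y) \<le> eval_at k (- (x + y))"
    using eval_at_superadd[of "- x" "- y"] by (simp add: algebra_simps)
  then show "eval_at k (x + y) \<le> eval_at k x + eval_at k y"
    by (simp only: eval_at_minus)
qed (rule eval_at_superadd)

lemma eval_at_diff: "eval_at k (x - y) = eval_at k x - eval_at k y"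
  using eval_at_add[of x "- y"] by (simp add: eval_at_minus)

lemma eval_at_0: "eval_at k 0 = 0"
  using eval_at_diff[of 0 0] by simp

lemma eval_at_scaleR_le:
  assumes "0 < c"
  shows "c * eval_at k x \<le> eval_at k (c *\<^sub>R x)"
proof (rule dense_le)
  fix a assume "a < c * eval_at k x"
  then have "locally_nonneg k (c *\<^sub>R (x - (a / c) *\<^sub>R e))"
    using assms by (intro locally_nonneg_scaleR locally_nonneg_below) (auto simp: field_simps)
  then show "a \<le> eval_at k (c *\<^sub>R x)"
    using assms by (intro le_eval_at) (simp add: algebra_simps)
qed

lemma eval_at_scaleR: "eval_at k (c *\<^sub>R x) = c * eval_at k x"
proof -
  have pos: "eval_at k (c *\<^sub>R x) = c * eval_at k x" if "0 < c" for c x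
  proof (rule antisym)
    have "c * eval_at k (- x) \<le> eval_at k (c *\<^sub>R (- x))"
      using that by (rule eval_at_scaleR_le)
    then show "eval_at k (c *\<^sub>R x) \<le> c * eval_at k x"
      by (simp add: eval_at_minus)
  qed (use that in \<open>rule eval_at_scaleR_le\<close>)
  consider "0 < c" | "c = 0" | "0 < - c" by linarith
  then show ?thesis
  proof cases
    case 3
    then show ?thesis
      using pos[of "- c" x] by (simp add: eval_at_minus)
  qed (auto simp: pos eval_at_0)
qed

lemma eval_at_inf: "eval_at k (inf x y) = min (eval_at k x) (eval_at k y)"
proof (rule antisym)
  show "min (eval_at k x) (eval_at k y) \<le> eval_at k (inf x y)"
  proof (rule dense_le)
    fix a assume "a < min (eval_at k x) (eval_at k y)"
    then have "locally_nonneg k (inf (x - a *\<^sub>R e) (y - a *\<^sub>R e))"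
      by (intro locally_nonneg_inf locally_nonneg_below) auto
    then show "a \<le> eval_at k (inf x y)"
      using add_inf_distrib_right[of x y "- (a *\<^sub>R e)"] by (intro le_eval_at) simp
  qed
qed (simp add: eval_at_mono)

lemma eval_at_abs: "eval_at k \<bar>x\<bar> = \<bar>eval_at k x\<bar>"
proof -
  have "\<bar>x\<bar> = - inf (- x) x"
    using sup_eq_neg_inf[of x "- x"] by (simp only: abs_lattice minus_minus)
  then have "eval_at k \<bar>x\<bar> = - min (- eval_at k x) (eval_at k x)"
    by (simp only: eval_at_minus eval_at_inf)
  then show ?thesis
    by (simp add: min_def abs_if)
qed

lemma eval_at_unit: "eval_at k e = 1"
proof (rule antisym)
  show "eval_at k e \<le> 1"
    using locally_nonneg_nonneg[OF k, of 0] by (intro eval_at_le) simp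
  show "1 \<le> eval_at k e"
    using locally_nonneg_nonneg[OF k, of 0] by (intro le_eval_at) simp
qed

end

section \<open>Order and continuity in terms of evaluations\<close>

lemma nonneg_if_eval_at_nonneg:
  assumes "\<And>k. k \<in> topspace K \<Longrightarrow> 0 \<le> eval_at k x"
  shows "0 \<le> x"
proof -
  have "- x \<le> c *\<^sub>R e" if "0 < c" for c
  proof -
    let ?a = "pprt (- (x - (- c) *\<^sub>R e))"
    \<comment> \<open>The slack \<open>c\<close> makes \<open>- c\<close> strictly smaller than the
      value at each point, which gives a witness \<open>u\<close> there. As \<open>T u k\<close> is
      positive, disjointness forces \<open>T ?a k = 0\<close>.\<close>
    have "T ?a k = 0" for k
    proof (cases "k \<in> topspace K")
      case True
      then have "locally_nonneg k (x - (- c) *\<^sub>R e)"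
        using assms[OF True] that by (intro locally_nonneg_below) auto
      then obtain u where u: "0 \<le> u" "0 < T u k" "inf u ?a = 0"
        unfolding locally_nonneg_def by blast
      then have "min (T u k) (T ?a k) = 0"
        using T_inf_at[of u ?a k] by (simp add: T_0)
      then show ?thesis
        using u by (auto simp: min_def split: if_splits)
    next
      case False
      then show ?thesis
        using continuous_functionsD(2)[OF T_in] by blast
    qed
    then have "T ?a = T 0"
      by (auto simp: T_0)
    then have "?a = 0"
      by (metis S_T)
    then have "- (x - (- c) *\<^sub>R e) \<le> 0"
      by (simp only: le_zero_iff_zero_pprt)
    then show ?thesis
      by (simp add: algebra_simps)
  qed
  then have "- x \<le> 0"
    by (rule banach_lattice_archimedean')
  then show ?thesis
    by simp
qed

lemma abs_le_if_eval_at_le: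
  assumes "\<And>k. k \<in> topspace K \<Longrightarrow> \<bar>eval_at k x\<bar> \<le> c"
  shows "\<bar>x\<bar> \<le> c *\<^sub>R e"
proof -
  have "0 \<le> c *\<^sub>R e - \<bar>x\<bar>"
    using assms by (intro nonneg_if_eval_at_nonneg)
      (simp add: eval_at_diff eval_at_scaleR eval_at_unit eval_at_abs)
  then show ?thesis
    by simp
qed

text \<open>A witness at \<open>k\<close> is a witness at every point where \<open>T u\<close> is
  positive, and these points form an open set. The intermediate \<open>b\<close> preserves the
  strict inequality.\<close>

lemma eval_at_open:
  "openin K {k \<in> topspace K. a < eval_at k x}"
proof (subst openin_subopen, intro ballI)
  fix k assume "k \<in> {k \<in> topspace K. a < eval_at k x}"
  then have k: "k \<in> topspace K" "a < eval_at k x"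
    by auto
  then obtain b where b: "a < b" "b < eval_at k x"
    using dense by blast
  then obtain u where u: "0 \<le> u" "0 < T u k" "inf u (pprt (- (x - b *\<^sub>R e))) = 0"
    using locally_nonneg_below[OF k(1)] unfolding locally_nonneg_def by blast
  let ?U = "{l \<in> topspace K. T u l \<in> {0<..}}"
  have "openin K ?U"
    using continuous_functionsD(1)[OF T_in] by (rule openin_continuous_map_preimage) simp
  moreover have "?U \<subseteq> {k \<in> topspace K. a < eval_at k x}"
  proof
    fix l assume l: "l \<in> ?U"
    then have "locally_nonneg l (x - b *\<^sub>R e)"
      using u by (auto simp: locally_nonneg_def)
    then have "b \<le> eval_at l x"
      using l by (intro le_eval_at) auto
    then show "l \<in> {k \<in> topspace K. a < eval_at k x}"
      using l b by auto
  qed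
  ultimately show "\<exists>U. openin K U \<and> k \<in> U \<and> U \<subseteq> {k \<in> topspace K. a < eval_at k x}"
    using k u by blast
qed

lemma eval_at_continuous: "continuous_map K euclideanreal (\<lambda>k. eval_at k x)"
  unfolding continuous_map_upper_lower_semicontinuous_lt
proof (intro allI conjI)
  fix a
  show "openin K {k \<in> topspace K. a < eval_at k x}"
    by (rule eval_at_open)
  have "{k \<in> topspace K. eval_at k x < a} = {k \<in> topspace K. - a < eval_at k (- x)}"
    by (auto simp: eval_at_minus)
  then show "openin K {k \<in> topspace K. eval_at k x < a}"
    by (simp only: eval_at_open)
qed

section \<open>Surjectivity by successive approximation\<close>

lemma separating_vector:
  assumes "closedin K P" "closedin K Q" "P \<inter> Q = {}"
  obtains v where "0 \<le> v" "v \<le> e"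
    "\<And>k. k \<in> P \<Longrightarrow> eval_at k v = 0" "\<And>k. k \<in> Q \<Longrightarrow> eval_at k v = 1"
proof -
  have PQ: "P \<subseteq> topspace K" "Q \<subseteq> topspace K"
    using assms closedin_subset by auto
  obtain g where g: "continuous_map K (top_of_set {0..1::real}) g" "g ` P \<subseteq> {0}" "g ` Q \<subseteq> {1}"
    using Urysohn_lemma[OF normal assms(1,2), of 0 1] assms(3) by (auto simp: disjnt_def)
  then have g: "continuous_map K euclideanreal g" "\<And>k. k \<in> P \<Longrightarrow> g k = 0" "\<And>k. k \<in> Q \<Longrightarrow> g k = 1"
    by (auto simp: continuous_map_in_subtopology)
  \<comment> \<open>The cut-off \<open>f\<close> is 0 where g is at most 1/3 and equals
    \<open>T e\<close> where g is at least 2/3. The bumps \<open>p\<close> and \<open>q\<close> live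
    on these two regions and are positive on \<open>P\<close> and \<open>Q\<close>, so
    \<open>S p\<close> and \<open>S q\<close> serve as witnesses.\<close>
  define f where "f = (\<lambda>k. if k \<in> topspace K then T e k * max 0 (min 1 (3 * g k - 1)) else 0)"
  define p where "p = (\<lambda>k. if k \<in> topspace K then max 0 (1/3 - g k) else 0)"
  define q where "q = (\<lambda>k. if k \<in> topspace K then max 0 (g k - 2/3) else 0)"
  have mem: "f \<in> continuous_functions K" "p \<in> continuous_functions K" "q \<in> continuous_functions K"
    unfolding f_def p_def q_def
    by (intro restriction_in_continuous_functions continuous_map_real_max continuous_map_real_min
        continuous_map_real_mult continuous_map_diff continuous_map_canonical_const
        continuous_functionsD(1)[OF T_in] g(1))+
  note T_S_mem = mem[THEN T_S]
  have nonneg: "0 \<le> f" "0 \<le> p" "0 \<le> q"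
    by (auto simp: f_def p_def q_def le_fun_def T_nonneg_at e_nonneg)
  have f_le: "f \<le> T e"
    using continuous_functionsD(2)[OF T_in]
    by (auto simp: f_def le_fun_def T_nonneg_at e_nonneg intro!: mult_left_le)
  have S_nonneg: "0 \<le> S f" "0 \<le> S p" "0 \<le> S q"
    using mem nonneg by (auto intro: S.T_nonneg)
  have Sf_le: "S f \<le> e"
    using f_le mem by (metis T_S T_le_iff)
  show ?thesis
  proof (rule that[of "S f"])
    fix k assume "k \<in> P"
    then have k: "k \<in> topspace K" "0 < T (S p) k"
      unfolding T_S_mem using PQ by (auto simp: p_def g)
    have "inf f p = 0"
    proof
      fix l
      have "max 0 (min 1 (3 * g l - 1)) = 0 \<or> max 0 (1/3 - g l) = 0"
        by (cases "1/3 < g l") auto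
      then have "f l = 0 \<or> p l = 0"
        by (auto simp: f_def p_def)
      moreover have "0 \<le> f l" "0 \<le> p l"
        using nonneg by (auto simp: le_fun_def)
      ultimately show "inf f p l = 0 l"
        by (auto simp: inf_real_def)
    qed
    then have "inf (S p) (S f) = 0"
      using mem by (subst inf_commute) (intro S.T_inf_eq_0)
    then have "locally_nonneg k (0 *\<^sub>R e - S f)"
      using k S_nonneg by (auto simp: locally_nonneg_def)
    then have "eval_at k (S f) \<le> 0"
      by (rule eval_at_le[OF k(1)])
    moreover have "0 \<le> eval_at k (S f)"
      using eval_at_mono[OF k(1) S_nonneg(1)] by (simp add: eval_at_0 k)
    ultimately show "eval_at k (S f) = 0"
      by simp
  next
    fix k assume "k \<in> Q"
    then have k: "k \<in> topspace K" "0 < T (S q) k"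
      unfolding T_S_mem using PQ by (auto simp: q_def g)
    have "inf (T e - f) q = 0"
    proof
      fix l
      have "min 1 (3 * g l - 1) = 1" if "2/3 < g l"
        using that by auto
      then have "q l = 0 \<or> T e l - f l = 0"
        by (cases "2/3 < g l") (auto simp: f_def q_def)
      moreover have "0 \<le> T e l - f l" "0 \<le> q l"
        using f_le nonneg by (auto simp: le_fun_def)
      ultimately show "inf (T e - f) q l = 0 l"
        by (auto simp: inf_real_def)
    qed
    \<comment> \<open>Agreement of \<open>T e\<close> and \<open>f\<close> on the support of
      \<open>q\<close> is carried back by the nonlinear map \<open>S\<close>.\<close>
    then have "inf (S (T e) - S f) (S q) = 0"
      using mem f_le nonneg by (intro S.T_diff_disjoint) (auto simp: T_in)
    then have "inf (S q) (pprt (- (S f - 1 *\<^sub>R e))) = 0"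
      using Sf_le by (simp add: S_T inf_commute)
    then have "locally_nonneg k (S f - 1 *\<^sub>R e)"
      using k S_nonneg unfolding locally_nonneg_def by blast
    then have "1 \<le> eval_at k (S f)"
      by (rule le_eval_at[OF k(1)])
    moreover have "eval_at k (S f) \<le> 1"
      using eval_at_mono[OF k(1) Sf_le] by (simp add: eval_at_unit k)
    ultimately show "eval_at k (S f) = 1"
      by simp
  qed (use S_nonneg Sf_le in auto)
qed

text \<open>Tietze's step: the approximant is -c/3 where f is at most -c/3, c/3 where f is at least
  c/3, and between these values elsewhere.\<close>

lemma approximation_step:
  assumes f: "continuous_map K euclideanreal f" and bound: "\<And>k. k \<in> topspace K \<Longrightarrow> \<bar>f k\<bar> \<le> c"
    and c: "0 < c"
  shows "\<exists>x. \<forall>k\<in>topspace K. \<bar>f k - eval_at k x\<bar> \<le> 2/3 * c"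
proof -
  let ?P = "{k \<in> topspace K. f k \<in> {..- c/3}}" and ?Q = "{k \<in> topspace K. f k \<in> {c/3..}}"
  have "closedin K ?P" "closedin K ?Q"
    by (rule closedin_continuous_map_preimage[OF f]; simp)+
  moreover have "?P \<inter> ?Q = {}"
    using c by auto
  ultimately obtain v where v: "0 \<le> v" "v \<le> e"
    "\<And>k. k \<in> ?P \<Longrightarrow> eval_at k v = 0" "\<And>k. k \<in> ?Q \<Longrightarrow> eval_at k v = 1"
    by (rule separating_vector) blast
  have "\<bar>f k - eval_at k ((2 * c / 3) *\<^sub>R v - (c / 3) *\<^sub>R e)\<bar> \<le> 2/3 * c" if k: "k \<in> topspace K" for k
  proof -
    have eval: "eval_at k ((2 * c / 3) *\<^sub>R v - (c / 3) *\<^sub>R e) = 2/3 * (c * eval_at k v) - c / 3"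
      using k by (simp add: eval_at_diff eval_at_scaleR eval_at_unit)
    have "0 \<le> eval_at k v" "eval_at k v \<le> 1"
      using eval_at_mono[OF k v(1)] eval_at_mono[OF k v(2)] k by (auto simp: eval_at_0 eval_at_unit)
    then have range: "0 \<le> c * eval_at k v" "c * eval_at k v \<le> c"
      using c by auto
    consider "f k \<le> - c/3" | "c/3 \<le> f k" | "- c/3 < f k" "f k < c/3"
      by linarith
    then show ?thesis
    proof cases
      case 1
      then have "eval_at k v = 0" using k by (intro v) auto
      then show ?thesis unfolding eval using 1 bound[OF k] by (auto simp: abs_le_iff)
    next
      case 2
      then have "eval_at k v = 1" using k by (intro v) auto
      then show ?thesis unfolding eval using 2 bound[OF k] by (auto simp: abs_le_iff)
    next
      case 3
      then show ?thesis unfolding eval abs_le_iff using range by linarith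
    qed
  qed
  then show ?thesis by blast
qed

lemma approximation:
  assumes f: "continuous_map K euclideanreal f" and bound: "\<And>k. k \<in> topspace K \<Longrightarrow> \<bar>f k\<bar> \<le> c"
    and c: "0 < c"
  shows "\<exists>x. \<forall>k\<in>topspace K. \<bar>f k - eval_at k x\<bar> \<le> (2/3)^n * c"
proof (induction n)
  case 0
  then show ?case
    using bound by (intro exI[of _ 0]) (simp add: eval_at_0)
next
  case (Suc n)
  then obtain x where x: "\<And>k. k \<in> topspace K \<Longrightarrow> \<bar>f k - eval_at k x\<bar> \<le> (2/3)^n * c"
    by blast
  have "continuous_map K euclideanreal (\<lambda>k. f k - eval_at k x)"
    by (intro continuous_intros f eval_at_continuous)
  then obtain y where "\<forall>k\<in>topspace K. \<bar>f k - eval_at k x - eval_at k y\<bar> \<le> 2/3 * ((2/3)^n * c)"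
    using approximation_step x c by (metis (no_types, lifting) mult_pos_pos zero_less_divide_iff zero_less_numeral zero_less_power)
  then show ?case
    by (intro exI[of _ "x + y"]) (simp add: eval_at_add algebra_simps)
qed

text \<open>Uniform closeness of evaluations becomes an order bound by a small multiple of
  \<open>e\<close>, hence a norm bound, and completeness supplies the limit.\<close>

lemma eval_at_onto:
  assumes f: "continuous_map K euclideanreal f" and bound: "\<And>k. k \<in> topspace K \<Longrightarrow> \<bar>f k\<bar> \<le> c"
    and c: "0 < c"
  shows "\<exists>x. \<forall>k\<in>topspace K. eval_at k x = f k"
proof -
  define r :: "nat \<Rightarrow> real" where "r n = (2/3)^n * c" for n
  have "\<forall>n. \<exists>x. \<forall>k\<in>topspace K. \<bar>f k - eval_at k x\<bar> \<le> r n"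
    using approximation[OF assms] by (simp add: r_def)
  then obtain X where X: "\<And>n k. k \<in> topspace K \<Longrightarrow> \<bar>f k - eval_at k (X n)\<bar> \<le> r n"
    by metis
  have r: "decseq r" "r \<longlonglongrightarrow> 0"
  proof -
    show "decseq r"
      using c unfolding r_def by (intro decseq_SucI mult_right_mono) auto
    have "(\<lambda>n. (2/3::real)^n) \<longlonglongrightarrow> 0"
      by (rule LIMSEQ_power_zero) simp
    then show "r \<longlonglongrightarrow> 0"
      unfolding r_def by (rule tendsto_mult_left_zero)
  qed
  have diff: "\<bar>X m - X n\<bar> \<le> (2 * r N) *\<^sub>R e" if "N \<le> m" "N \<le> n" for m n N
  proof (rule abs_le_if_eval_at_le)
    fix k assume k: "k \<in> topspace K"
    have "r m \<le> r N" "r n \<le> r N"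
      using r(1) that by (auto simp: decseq_def)
    then show "\<bar>eval_at k (X m - X n)\<bar> \<le> 2 * r N"
      using X[OF k, of m] X[OF k, of n] by (auto simp: eval_at_diff[OF k])
  qed
  have r0: "0 \<le> r n" for n
    using c by (simp add: r_def)
  have "Cauchy X"
  proof (rule CauchyI)
    fix \<epsilon> :: real assume "0 < \<epsilon>"
    have "(\<lambda>n. 2 * r n * norm e) \<longlonglongrightarrow> 2 * 0 * norm e"
      by (intro tendsto_intros r)
    then have "eventually (\<lambda>n. 2 * r n * norm e < \<epsilon>) sequentially"
      using \<open>0 < \<epsilon>\<close> by (intro order_tendstoD(2)) auto
    then obtain N where N: "2 * r N * norm e < \<epsilon>"
      by (auto simp: eventually_sequentially)
    have "norm (X m - X n) < \<epsilon>" if "N \<le> m" "N \<le> n" for m n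
    proof -
      have "norm (X m - X n) \<le> norm ((2 * r N) *\<^sub>R e)"
        using diff[OF that] r0[of N] e_nonneg
        by (intro norm_le_of_abs_le) (simp add: abs_of_nonneg scaleR_nonneg_nonneg)
      then show ?thesis
        using N r0[of N] by simp
    qed
    then show "\<exists>M. \<forall>m\<ge>M. \<forall>n\<ge>M. norm (X m - X n) < \<epsilon>"
      by blast
  qed
  then obtain x where x: "X \<longlonglongrightarrow> x"
    using Cauchy_convergent by (auto simp: convergent_def)
  \<comment> \<open>Order bounds survive the limit as the cone is closed; they control the
    evaluation of \<open>x\<close>.\<close>
  have lim: "x - X n \<le> (2 * r n) *\<^sub>R e" "X n - x \<le> (2 * r n) *\<^sub>R e" for n
  proof -
    have "eventually (\<lambda>m. X m - X n \<le> (2 * r n) *\<^sub>R e) sequentially"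
      using eventually_ge_at_top[of n] by eventually_elim (use diff abs_le_iff in blast)
    then show "x - X n \<le> (2 * r n) *\<^sub>R e"
      by (rule banach_lattice_limit_le[rotated]) (intro tendsto_intros x)
    have "eventually (\<lambda>m. X n - X m \<le> (2 * r n) *\<^sub>R e) sequentially"
      using eventually_ge_at_top[of n] by eventually_elim (use diff abs_le_iff in blast)
    then show "X n - x \<le> (2 * r n) *\<^sub>R e"
      by (rule banach_lattice_limit_le[rotated]) (intro tendsto_intros x)
  qed
  have "eval_at k x = f k" if k: "k \<in> topspace K" for k
  proof -
    \<comment> \<open>One \<open>r n\<close> comes from the approximation and \<open>2 * r n\<close>
      from the passage to the limit.\<close>
    have le: "\<bar>f k - eval_at k x\<bar> \<le> 3 * r n" for n
      using X[OF k, of n] eval_at_mono[OF k lim(1)[of n]] eval_at_mono[OF k lim(2)[of n]]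
      by (auto simp: eval_at_diff[OF k] eval_at_scaleR[OF k] eval_at_unit[OF k])
    have "(\<lambda>n. 3 * r n) \<longlonglongrightarrow> 3 * 0"
      by (intro tendsto_intros r)
    then have "\<bar>f k - eval_at k x\<bar> \<le> 3 * 0"
      by (rule LIMSEQ_le_const) (use le in auto)
    then show ?thesis by simp
  qed
  then show ?thesis by blast
qed

section \<open>The lattice isomorphism onto C(K)\<close>

lemma lattice_isomorphism_eval_at:
  assumes bdd: "\<And>f. continuous_map K euclideanreal f \<Longrightarrow> \<exists>c>0. \<forall>k\<in>topspace K. \<bar>f k\<bar> \<le> c"
  shows "lattice_isomorphism (UNIV :: 'e set) (continuous_functions K)
    (\<lambda>x k. if k \<in> topspace K then eval_at k x else 0)" (is "lattice_isomorphism _ _ ?J")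
proof -
  have "inj ?J"
  proof (rule injI)
    fix x y assume J: "?J x = ?J y"
    have eq: "eval_at k x = eval_at k y" if "k \<in> topspace K" for k
      using fun_cong[OF J, of k] that by simp
    have "0 \<le> x - y" "0 \<le> y - x"
      by (rule nonneg_if_eval_at_nonneg, simp add: eval_at_diff eq)+
    then show "x = y"
      by simp
  qed
  moreover have "range ?J = continuous_functions K"
  proof
    show "range ?J \<subseteq> continuous_functions K"
      using restriction_in_continuous_functions[OF eval_at_continuous] by blast
    show "continuous_functions K \<subseteq> range ?J"
    proof
      fix f assume f: "f \<in> continuous_functions K"
      then obtain x where "\<forall>k\<in>topspace K. eval_at k x = f k"
        using continuous_functionsD(1)[OF f] bdd eval_at_onto by metis
      then have "f = ?J x"
        using continuous_functionsD(2)[OF f] by auto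
      then show "f \<in> range ?J"
        by blast
    qed
  qed
  ultimately show ?thesis
    by (auto simp: lattice_isomorphism_def bij_betw_def fun_eq_iff scaleR_fun_def abs_fun_def
        eval_at_add eval_at_scaleR eval_at_abs)
qed

end

lemma compact_space_continuous_bounded:
  assumes "compact_space K" "continuous_map K euclideanreal f"
  shows "\<exists>c>0. \<forall>k\<in>topspace K. \<bar>f k\<bar> \<le> c"
proof -
  have "compact (f ` topspace K)"
    using image_compactin[OF _ assms(2)] assms(1) by (simp add: compact_space_def)
  then show ?thesis
    using compact_imp_bounded[of "f ` topspace K"] by (auto simp: bounded_pos)
qed

theorem theorem1:
  fixes K :: "'k topology"
  assumes "compact_space K" and "Hausdorff_space K"
    and "order_isomorphic (UNIV :: 'e::banach_lattice set) (continuous_functions K)"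
  shows "lattice_isomorphic (UNIV :: 'e set) (continuous_functions K)"
proof -
  let ?C = "continuous_functions K"
  obtain T0 :: "'e \<Rightarrow> 'k \<Rightarrow> real" where T0: "bij_betw T0 UNIV ?C" "\<And>x y. T0 y \<le> T0 x \<longleftrightarrow> y \<le> x"
    using assms(3) by (auto simp: order_isomorphic_def order_isomorphism_def)
  have T0_in: "T0 x \<in> ?C" for x
    using T0(1) by (auto simp: bij_betw_def)
  \<comment> \<open>Translation preserves the order and moves the image of 0 to 0.\<close>
  define T where "T x = T0 x - T0 0" for x
  define S where "S f = inv T0 (f + T0 0)" for f
  have T_in: "T x \<in> ?C" for x
    unfolding T_def by (intro continuous_functions_diff T0_in)
  have S_T: "S (T x) = x" for x
    using T0(1) by (simp add: S_def T_def bij_betw_def)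
  have T_S: "T (S f) = f" if "f \<in> ?C" for f
  proof -
    have "f + T0 0 \<in> range T0"
      using T0(1) continuous_functions_closed(2)[OF that T0_in] by (auto simp: bij_betw_def)
    then show ?thesis
      by (simp add: S_def T_def f_inv_into_f)
  qed
  have T_le_iff: "T x \<le> T y \<longleftrightarrow> x \<le> y" for x y
    by (simp add: T_def T0(2))
  have T_0: "T 0 = 0"
    by (simp add: T_def)
  \<comment> \<open>By compactness the constants n are cofinal in C(K), so their preimages are
    cofinal in the Banach lattice and a vector dominating them is an order unit.\<close>
  define one where "one n = (\<lambda>k. if k \<in> topspace K then real n else 0)" for n
  have one: "one n \<in> ?C" "0 \<le> one n" for n
    unfolding one_def by (auto intro!: restriction_in_continuous_functions simp: le_fun_def)
  have "0 \<le> S (one n)" for n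
    using one by (metis T_0 T_S T_le_iff)
  then obtain e where e: "0 \<le> e" "\<And>n. \<exists>c\<ge>0. S (one n) \<le> c *\<^sub>R e"
    using dominating_element[of "\<lambda>n. S (one n)"] by blast
  have unit: "\<exists>c\<ge>0. x \<le> c *\<^sub>R e" for x
  proof -
    obtain b where b: "\<And>k. k \<in> topspace K \<Longrightarrow> \<bar>T x k\<bar> \<le> b"
      using compact_space_continuous_bounded[OF assms(1) continuous_functionsD(1)[OF T_in]] by blast
    obtain n where "b \<le> real n"
      using real_arch_simple by blast
    then have "T x k \<le> one n k" for k
      using b[of k] continuous_functionsD(2)[OF T_in] by (auto simp: one_def)
    then have "T x \<le> T (S (one n))"
      by (simp add: T_S one le_fun_def)
    then show ?thesis
      using e(2)[of n] order_trans by (auto simp: T_le_iff)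
  qed
  have "normal_space K"
    using assms(1,2) by (simp add: compact_Hausdorff_or_regular_imp_normal_space)
  then interpret order_iso_to_continuous_functions K T S e
    by unfold_locales (use T_in S_T T_S T_le_iff T_0 e(1) unit in auto)
  show ?thesis
    unfolding lattice_isomorphic_def
    using lattice_isomorphism_eval_at[OF compact_space_continuous_bounded[OF assms(1)]] by blast
qed

end
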